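(* If $G$ is a regular dense-subgroup-separable abelian semitopological group with $r_{0}(G)\geq\mathfrak{c}$, then $G$ is $d$-independent.
   Context: All spaces are Hausdorff; $\mathfrak{c}=|\mathbb{R}|$; $e$ is the neutral element of $G$ (written additively). A semitopological group is a group with a topology for which all left and right translations are continuous. It is dense-subgroup-separable if each of its dense subgroups is separable. A nontrivial semitopological group $G$ is $d$-independent if for every subgroup $S$ of $G$ with $|S|<\mathfrak{c}$ there is a countable dense subgroup $H$ of $G$ such that $S\cap H=\{e\}$. A nonempty subset $B$ of an abelian group is independent if, for any pairwise distinct $b_1,\dots,b_m\in B$ and integers $n_1,\dots,n_m$, $n_1b_1+\cdots+n_mb_m=e$ implies $n_ib_i=e$ for every $i$. The torsion-free rank $r_0(G)$ is the cardinality of a maximal (by inclusion) independent subset of $G$ consisting of elements of infinite order. *)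

theory Defs
  imports "HOL-Algebra.Multiplicative_Group" "HOL-Analysis.Abstract_Topological_Spaces"
begin

unbundle cardinal_syntax

text \<open>
  Groups are those of HOL-Algebra, hence written multiplicatively: \<open>\<one>\<close> is the neutral element
  and \<open>b [^] k\<close> is the multiple \<open>kb\<close> of the additive notation.  Topologies are
  those of HOL-Analysis; separation axioms are not built in and are assumed where needed.
\<close>

locale semitopological_group = group G for G (structure) +
  fixes T :: "'a topology"
  assumes topspace_eq_carrier: "topspace T = carrier G"
    and continuous_left_translation: "a \<in> carrier G \<Longrightarrow> continuous_map T T (\<lambda>x. a \<otimes> x)"
    and continuous_right_translation: "a \<in> carrier G \<Longrightarrow> continuous_map T T (\<lambda>x. x \<otimes> a)"

definition dense_subgroup :: "'a set \<Rightarrow> ('a, 'b) monoid_scheme \<Rightarrow> 'a topology \<Rightarrow> bool" where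
  "dense_subgroup H G T \<longleftrightarrow> subgroup H G \<and> T closure_of H = topspace T"

definition dense_subgroup_separable :: "('a, 'b) monoid_scheme \<Rightarrow> 'a topology \<Rightarrow> bool" where
  "dense_subgroup_separable G T \<longleftrightarrow>
     (\<forall>H. dense_subgroup H G T \<longrightarrow> separable_space (subtopology T H))"

definition d_independent :: "('a, 'b) monoid_scheme \<Rightarrow> 'a topology \<Rightarrow> bool" where
  "d_independent G T \<longleftrightarrow>
     semitopological_group G T \<and> carrier G \<noteq> {\<one>\<^bsub>G\<^esub>} \<and>
     (\<forall>S. subgroup S G \<and> |S| <o |UNIV :: real set| \<longrightarrow>
        (\<exists>H. dense_subgroup H G T \<and> countable H \<and> S \<inter> H = {\<one>\<^bsub>G\<^esub>}))"

definition independent_subset :: "('a, 'b) monoid_scheme \<Rightarrow> 'a set \<Rightarrow> bool" where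
  "independent_subset G B \<longleftrightarrow>
     B \<noteq> {} \<and> B \<subseteq> carrier G \<and>
     (\<forall>F (n :: 'a \<Rightarrow> int). finite F \<and> F \<subseteq> B \<and> (\<Otimes>\<^bsub>G\<^esub>b\<in>F. b [^]\<^bsub>G\<^esub> n b) = \<one>\<^bsub>G\<^esub> \<longrightarrow>
        (\<forall>b\<in>F. b [^]\<^bsub>G\<^esub> n b = \<one>\<^bsub>G\<^esub>))"

text \<open>
  Independent sets are nonempty by definition.  The empty set is admitted here so that the
  rank of a torsion group is \<open>0\<close>.  The library's \<open>group.ord\<close> is \<open>0\<close>
  exactly on the elements of infinite order.
\<close>

definition torsion_free_independent :: "('a, 'b) monoid_scheme \<Rightarrow> 'a set \<Rightarrow> bool" where
  "torsion_free_independent G B \<longleftrightarrow>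
     (B = {} \<or> independent_subset G B) \<and> (\<forall>b\<in>B. group.ord G b = 0)"

definition maximal_torsion_free_independent :: "('a, 'b) monoid_scheme \<Rightarrow> 'a set \<Rightarrow> bool" where
  "maximal_torsion_free_independent G B \<longleftrightarrow>
     torsion_free_independent G B \<and>
     (\<forall>C. torsion_free_independent G C \<and> B \<subseteq> C \<longrightarrow> C = B)"

definition torsion_free_rank :: "('a, 'b) monoid_scheme \<Rightarrow> 'a rel" where
  "torsion_free_rank G = |SOME B. maximal_torsion_free_independent G B|"

text \<open>The choice in \<open>torsion_free_rank\<close> is never vacuous.\<close>

lemma ex_maximal_torsion_free_independent:
  "\<exists>B. maximal_torsion_free_independent G B"
proof -
  let ?A = "{B. torsion_free_independent G B}"
  have "\<exists>M\<in>?A. \<forall>X\<in>?A. M \<subseteq> X \<longrightarrow> X = M"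
  proof (rule subset_Zorn_nonempty)
    show "?A \<noteq> {}"
      by (auto simp: torsion_free_independent_def intro: exI[of _ "{}"])
    fix \<C> assume ne: "\<C> \<noteq> {}" and ch: "subset.chain ?A \<C>"
    have tf: "torsion_free_independent G B" if "B \<in> \<C>" for B
      using ch that by (auto simp: subset.chain_def)
    have "independent_subset G (\<Union>\<C>)" if nonempty: "\<Union>\<C> \<noteq> {}"
      unfolding independent_subset_def
    proof (intro conjI allI impI)
      show "\<Union>\<C> \<subseteq> carrier G"
        using tf by (fastforce simp: torsion_free_independent_def independent_subset_def)
      fix F and n :: "'a \<Rightarrow> int"
      assume F: "finite F \<and> F \<subseteq> \<Union>\<C> \<and> (\<Otimes>\<^bsub>G\<^esub>b\<in>F. b [^]\<^bsub>G\<^esub> n b) = \<one>\<^bsub>G\<^esub>"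
      then obtain B where B: "B \<in> \<C>" "F \<subseteq> B"
        using finite_subset_Union_chain[OF _ _ ne ch] by metis
      show "\<forall>b\<in>F. b [^]\<^bsub>G\<^esub> n b = \<one>\<^bsub>G\<^esub>"
      proof (cases "B = {}")
        case False
        then have "independent_subset G B"
          using tf[OF B(1)] by (simp add: torsion_free_independent_def)
        then show ?thesis using F B(2) unfolding independent_subset_def by blast
      qed (use B in auto)
    qed (fact nonempty)
    then show "\<Union>\<C> \<in> ?A"
      using tf by (auto simp: torsion_free_independent_def)
  qed
  then show ?thesis
    by (auto simp: maximal_torsion_free_independent_def)
qed

end

theory Submission
  imports Defs "HOL-Algebra.Generated_Groups" "HOL-Library.Countable_Set_Type"
begin

text \<open>
  Write \<open>\<cc>\<close> for the cardinality of the reals, and call a power nonzero if its integer exponent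
  is nonzero.  It suffices to find a dense subgroup \<open>K\<close>, of
  any size, that meets \<open>S\<close> trivially: by hypothesis \<open>K\<close> is separable, and the subgroup generated
  by a countable dense subset of \<open>K\<close> is countable, dense in the whole group and contained in \<open>K\<close>.

  The group itself has a countable dense subset \<open>D\<close>, so regularity provides a \<open>\<pi>\<close>-base of at most
  \<open>\<cc>\<close> open sets, namely the nonempty interiors of closures of subsets of \<open>D\<close>
  (\<open>regular_dense_pi_base\<close>).  List it along a well-order all of whose proper initial segments have
  fewer than \<open>\<cc>\<close> elements, and pick one point in each member by recursion, such that no nonzero
  power of the new point lies in the subgroup \<open>M\<close> generated by \<open>S\<close> and the earlier points.  The
  points picked generate a dense subgroup, and it meets \<open>S\<close> trivially, since in a nontrivial
  relation with \<open>S\<close> the last point that occurs would have a nonzero power in \<open>M\<close>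
  (\<open>generate_Int_trivial\<close>).

  The recursion never stops, because for a subset \<open>M\<close> with fewer than \<open>\<cc>\<close> elements the elements
  having a nonzero power in \<open>M\<close> cannot fill a nonempty open set \<open>U\<close>
  (\<open>open_has_element_free_modulo\<close>).  Otherwise, as the quotients of an element of \<open>D\<close> by an element of \<open>U\<close>
  exhaust the group, every element of the group has a nonzero power in the subgroup generated by
  \<open>M \<union> D\<close>.  This subgroup still has fewer than \<open>\<cc>\<close> elements, whereas mapping each member of an
  independent set of elements of infinite order to such a power is injective
  (\<open>independent_card_le\<close>); so the torsion-free rank would be less than \<open>\<cc>\<close>.
\<close>

section \<open>Generated subgroups\<close>

text \<open>
  Closing the generators under products countably many times, at most squaring the size of the set
  each time, exhausts the generated subgroup.
\<close>

lemma (in group) card_of_generate: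
  assumes X: "X \<subseteq> carrier G" and inf: "infinite Y" and le: "|X| \<le>o |Y|"
  shows "|generate G X| \<le>o |Y|"
proof -
  define W where
    "W = rec_nat (insert \<one> (X \<union> m_inv G ` X)) (\<lambda>_ A. (\<lambda>(x, y). x \<otimes> y) ` (A \<times> A))"
  have W0: "W 0 = insert \<one> (X \<union> m_inv G ` X)"
    and WSuc: "W (Suc n) = (\<lambda>(x, y). x \<otimes> y) ` (W n \<times> W n)" for n
    by (simp_all add: W_def)
  have car: "W n \<subseteq> carrier G" for n
    by (induction n) (use X in \<open>auto simp: W0 WSuc\<close>)
  have one: "\<one> \<in> W n" for n
    by (induction n) (force simp: W0 WSuc)+
  have "W n \<subseteq> W (Suc n)" for n
    using car[of n] one[of n] by (force simp: WSuc)
  then have mono: "W m \<subseteq> W n" if "m \<le> n" for m n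
    using that by (rule lift_Suc_mono_le)
  have Un: "|A \<union> B| \<le>o |Y|" if "|A| \<le>o |Y|" "|B| \<le>o |Y|" for A B :: "'a set"
    using card_of_Un_ordLeq_infinite_Field[of "|Y|" A B] inf that
    by (simp add: Field_card_of card_of_card_order_on)
  have "generate G X \<subseteq> (\<Union>n. W n)"
  proof
    fix y assume "y \<in> generate G X"
    then show "y \<in> (\<Union>n. W n)"
    proof induction
      case one then show ?case using \<open>\<And>n. \<one> \<in> W n\<close> by blast
    next
      case (incl h) then have "h \<in> W 0" by (simp add: W0) then show ?case by blast
    next
      case (inv h) then have "inv h \<in> W 0" by (simp add: W0) then show ?case by blast
    next
      case (eng h1 h2)
      then obtain m n where "h1 \<in> W m" "h2 \<in> W n" by blast
      then have "h1 \<in> W (max m n)" "h2 \<in> W (max m n)"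
        using mono by (meson max.cobounded1 max.cobounded2 subsetD)+
      then have "h1 \<otimes> h2 \<in> W (Suc (max m n))" by (force simp: WSuc)
      then show ?case by blast
    qed
  qed
  moreover have "|\<Union>n. W n| \<le>o |Y|"
  proof (rule card_of_UNION_ordLeq_infinite[OF inf])
    show "|UNIV :: nat set| \<le>o |Y|"
      using inf infinite_iff_card_of_nat by blast
    show "\<forall>n\<in>UNIV. |W n| \<le>o |Y|"
    proof
      fix n
      show "|W n| \<le>o |Y|"
      proof (induction n)
        case 0
        have "|m_inv G ` X| \<le>o |Y|"
          using card_of_image le ordLeq_transitive by blast
        then have "|X \<union> m_inv G ` X| \<le>o |Y|"
          using Un le by blast
        moreover have "|{\<one>}| \<le>o |Y|"
          using inf by (intro card_of_singl_ordLeq) auto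
        ultimately have "|{\<one>} \<union> (X \<union> m_inv G ` X)| \<le>o |Y|"
          using Un by blast
        then show ?case by (simp add: W0)
      next
        case (Suc n)
        have "|W n \<times> W n| \<le>o |Y|"
          using card_of_Times_ordLeq_infinite_Field[of "|Y|"] inf Suc
          by (simp add: Field_card_of card_of_card_order_on)
        then show ?case
          unfolding WSuc using card_of_image ordLeq_transitive by blast
      qed
    qed
  qed
  ultimately show ?thesis
    using card_of_mono1 ordLeq_transitive by blast
qed

lemma (in group) countable_generate:
  assumes "X \<subseteq> carrier G" "countable X"
  shows "countable (generate G X)"
  using card_of_generate[of X "UNIV :: nat set"] assms countable_card_of_nat by blast

lemma (in group) card_of_generate_less:
  assumes "X \<subseteq> carrier G" and X: "|X| <o |Y|" and Y: "|UNIV :: nat set| <o |Y|"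
  shows "|generate G X| <o |Y|"
proof (cases "finite X")
  case True
  then have "|generate G X| \<le>o |UNIV :: nat set|"
    using countable_generate[OF assms(1)] countable_card_of_nat countable_finite by blast
  then show ?thesis using Y ordLeq_ordLess_trans by blast
next
  case False
  then show ?thesis
    using card_of_generate[OF assms(1) False] X ordLeq_ordLess_trans
      card_of_refl ordIso_iff_ordLeq by blast
qed

lemma (in group) generate_finite_support:
  assumes "X \<subseteq> carrier G" "y \<in> generate G X"
  obtains F where "finite F" "F \<subseteq> X" "y \<in> generate G F"
proof -
  have "\<exists>F. finite F \<and> F \<subseteq> X \<and> y \<in> generate G F"
    using assms(2)
  proof induction
    case one
    then show ?case by (intro exI[of _ "{}"]) (auto intro: generate.one)
  next
    case (incl h)
    then show ?case by (intro exI[of _ "{h}"]) (auto intro: generate.incl)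
  next
    case (inv h)
    then show ?case by (intro exI[of _ "{h}"]) (auto intro: generate.inv)
  next
    case (eng h1 h2)
    then obtain F1 F2 where F: "finite F1" "F1 \<subseteq> X" "h1 \<in> generate G F1"
      "finite F2" "F2 \<subseteq> X" "h2 \<in> generate G F2" by blast
    then have "h1 \<in> generate G (F1 \<union> F2)" "h2 \<in> generate G (F1 \<union> F2)"
      using mono_generate[of F1 "F1 \<union> F2"] mono_generate[of F2 "F1 \<union> F2"] by blast+
    then show ?case
      using F by (intro exI[of _ "F1 \<union> F2"]) (auto intro: generate.eng)
  qed
  then show ?thesis using that by blast
qed

lemma (in comm_group) generate_insert_decompose:
  assumes x: "x \<in> carrier G" and X: "X \<subseteq> carrier G" and y: "y \<in> generate G (insert x X)"
  obtains k and n :: int where "k \<in> generate G X" "y = k \<otimes> x [^] n"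
proof -
  have "\<exists>k\<in>generate G X. \<exists>n::int. y = k \<otimes> x [^] n"
    using y
  proof induction
    case one
    show ?case
      by (intro bexI[of _ \<one>] exI[of _ 0]) (auto intro: generate.one)
  next
    case (incl h)
    show ?case
    proof (cases "h = x")
      case True
      with x show ?thesis
        by (intro bexI[of _ \<one>] exI[of _ 1]) (auto intro: generate.one simp: int_pow_1)
    next
      case False
      with incl X show ?thesis
        by (intro bexI[of _ h] exI[of _ 0]) (auto intro: generate.incl)
    qed
  next
    case (inv h)
    show ?case
    proof (cases "h = x")
      case True
      with x show ?thesis
        by (intro bexI[of _ \<one>] exI[of _ "- 1"])
          (auto intro: generate.one simp: int_pow_neg int_pow_1)
    next
      case False
      with inv X show ?thesis
        by (intro bexI[of _ "inv h"] exI[of _ 0]) (auto intro: generate.inv)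
    qed
  next
    case (eng h1 h2)
    then obtain k1 k2 and n1 n2 :: int
      where k: "k1 \<in> generate G X" "k2 \<in> generate G X"
        and h: "h1 = k1 \<otimes> x [^] n1" "h2 = k2 \<otimes> x [^] n2" by blast
    have c: "k1 \<in> carrier G" "k2 \<in> carrier G"
      using k generate_in_carrier[OF X] by auto
    have "h1 \<otimes> h2 = (k1 \<otimes> k2) \<otimes> x [^] (n1 + n2)"
      using c x by (simp add: h int_pow_mult m_ac)
    then show ?case using k by (meson generate.eng)
  qed
  then show ?thesis using that by blast
qed

section \<open>Avoiding a subgroup\<close>

lemma finite_Well_order_has_max:
  assumes "Well_order r" "finite F" "F \<noteq> {}" "F \<subseteq> Field r"
  obtains a where "a \<in> F" "F - {a} \<subseteq> underS r a"
proof -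
  have wo: "wo_rel r" using assms(1) by (simp add: wo_rel_def)
  have "\<exists>a\<in>F. F - {a} \<subseteq> underS r a"
    using assms(2-4)
  proof (induction rule: finite_ne_induct)
    case (singleton x)
    then show ?case by simp
  next
    case (insert x F)
    then obtain a where a: "a \<in> F" "F - {a} \<subseteq> underS r a" by auto
    then have "x \<noteq> a" using insert.hyps by blast
    then consider "x \<in> underS r a" | "a \<in> underS r x"
      using wo_rel.TOTALS[OF wo] insert.prems a(1) by (fastforce simp: underS_def)
    then show ?case
    proof cases
      case 1
      then show ?thesis using a by blast
    next
      case 2
      then have "underS r a \<subseteq> underS r x"
        using underS_incr[OF wo_rel.TRANS[OF wo] wo_rel.ANTISYM[OF wo]] by (simp add: underS_def)
      then show ?thesis using 2 a by blast
    qed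
  qed
  then show ?thesis using that by blast
qed

text \<open>
  A nontrivial element of the intersection, written with as few of the \<open>f i\<close> as possible, involves
  a nonzero power of the last \<open>f i\<close> used; solving for it contradicts the hypothesis on \<open>f i\<close>.
\<close>

lemma (in comm_group) generate_Int_trivial:
  assumes r: "Well_order r" and S: "subgroup S G"
    and f: "\<And>i. i \<in> Field r \<Longrightarrow> f i \<in> carrier G"
    and free: "\<And>i n. i \<in> Field r \<Longrightarrow> n \<noteq> 0 \<Longrightarrow>
      f i [^] (n::int) \<notin> generate G (S \<union> f ` underS r i)"
  shows "S \<inter> generate G (f ` Field r) = {\<one>}"
proof -
  have fin: "y = \<one>" if "finite F" "F \<subseteq> Field r" "y \<in> S" "y \<in> generate G (f ` F)" for F y
    using that
  proof (induction F rule: finite_psubset_induct)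
    case (psubset F)
    show ?case
    proof (cases "F = {}")
      case True
      then show ?thesis using psubset.prems by (simp add: generate_empty)
    next
      case False
      then obtain a where a: "a \<in> F" "F - {a} \<subseteq> underS r a"
        using finite_Well_order_has_max[OF r] psubset by metis
      let ?F = "F - {a}"
      have car: "f ` ?F \<subseteq> carrier G" "f a \<in> carrier G"
        using f psubset.prems(1) a(1) by auto
      have "y \<in> generate G (insert (f a) (f ` ?F))"
        using psubset.prems(3) a(1) by (simp flip: image_insert add: insert_absorb)
      then obtain k and n :: int where k: "k \<in> generate G (f ` ?F)" and y: "y = k \<otimes> f a [^] n"
        using generate_insert_decompose[OF car(2,1)] by metis
      let ?M = "generate G (S \<union> f ` underS r a)"
      have Mcar: "S \<union> f ` underS r a \<subseteq> carrier G"
        using subgroup.subset[OF S] f by (auto simp: underS_def Field_def)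
      have M: "subgroup ?M G" using generate_is_subgroup[OF Mcar] .
      have kM: "k \<in> ?M"
        using k mono_generate[of "f ` ?F" "S \<union> f ` underS r a"] a(2) by blast
      have yM: "y \<in> ?M" using psubset.prems(2) by (simp add: generate.incl)
      have kc: "k \<in> carrier G" using k generate_in_carrier[OF car(1)] by blast
      have "f a [^] n = inv k \<otimes> y"
        using kc car(2) by (simp add: y flip: m_assoc)
      then have "f a [^] n \<in> ?M"
        using kM yM M by (simp add: subgroup.m_closed subgroup.m_inv_closed)
      then have "n = 0" using free a(1) psubset.prems(1) by blast
      then have "y \<in> generate G (f ` ?F)" using k y kc by simp
      moreover have "?F \<subset> F" using a(1) by blast
      ultimately show ?thesis using psubset by blast
    qed
  qed
  have "y = \<one>" if y: "y \<in> S" "y \<in> generate G (f ` Field r)" for y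
  proof -
    have "f ` Field r \<subseteq> carrier G" using f by blast
    then obtain E where "finite E" "E \<subseteq> f ` Field r" "y \<in> generate G E"
      using generate_finite_support y(2) by metis
    moreover then obtain F where "finite F" "F \<subseteq> Field r" "E = f ` F"
      by (meson finite_subset_image)
    ultimately show ?thesis using fin y(1) by blast
  qed
  then show ?thesis
    using subgroup.one_closed[OF S] generate.one by blast
qed

section \<open>Independent sets and small subgroups\<close>

text \<open>
  If two members of \<open>B\<close> had a common nonzero power, this would be a relation between them that
  kills a nonzero power of an element of infinite order.
\<close>

lemma (in comm_group) independent_card_le:
  assumes B: "torsion_free_independent G B"
    and M: "\<And>b. b \<in> B \<Longrightarrow> \<exists>n::int. n \<noteq> 0 \<and> b [^] n \<in> M"
  shows "|B| \<le>o |M|"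
proof (cases "B = {}")
  case True
  then show ?thesis by (simp add: card_of_empty)
next
  case False
  then have ind: "independent_subset G B" and ord: "\<And>b. b \<in> B \<Longrightarrow> ord b = 0"
    using B by (auto simp: torsion_free_independent_def)
  have car: "B \<subseteq> carrier G" using ind by (simp add: independent_subset_def)
  obtain n :: "'a \<Rightarrow> int" where n: "\<And>b. b \<in> B \<Longrightarrow> n b \<noteq> 0 \<and> b [^] n b \<in> M"
    using M by metis
  have "inj_on (\<lambda>b. b [^] n b) B"
  proof (rule inj_onI, rule ccontr)
    fix b c assume bc: "b \<in> B" "c \<in> B" "b [^] n b = c [^] n c" "b \<noteq> c"
    define m where "m = n(c := - n c)"
    have c: "b \<in> carrier G" "c \<in> carrier G" using bc car by auto
    have "(\<Otimes>x\<in>{b, c}. x [^] m x) = b [^] n b \<otimes> inv (c [^] n c)"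
      using c bc(4) by (simp add: m_def int_pow_neg)
    also have "\<dots> = \<one>" using c bc(3) by simp
    finally have "finite {b, c} \<and> {b, c} \<subseteq> B \<and> (\<Otimes>x\<in>{b, c}. x [^] m x) = \<one>"
      using bc(1,2) by simp
    then have "\<forall>x\<in>{b, c}. x [^] m x = \<one>"
      by (rule ind[unfolded independent_subset_def, THEN conjunct2, THEN conjunct2,
            THEN spec, THEN spec, THEN mp])
    then have "b [^] m b = \<one>" by simp
    then have "n b = 0"
      using int_pow_eq_id[OF c(1)] ord bc(1,4) by (simp add: m_def)
    then show False using n bc(1) by blast
  qed
  then show ?thesis
    using n by (meson card_of_ordLeqI)
qed

lemma nat_less_real: "|UNIV :: nat set| <o |UNIV :: real set|"
proof -
  have "|UNIV :: nat set| <o |Pow (UNIV :: nat set)|" by (rule card_of_Pow)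
  moreover have "|UNIV :: nat set set| =o |UNIV :: real set|"
    using nat_sets_eqpoll_reals eqpoll_iff_card_of_ordIso by blast
  ultimately show ?thesis using ordLess_ordIso_trans by (metis Pow_UNIV)
qed

text \<open>
  For every \<open>x\<close> the translate of \<open>U\<close> by \<open>x\<close> is open and so meets the dense set \<open>D\<close>, which makes
  \<open>x\<close> a quotient of an element of \<open>D\<close> by one of \<open>U\<close>.  So if every element of \<open>U\<close>
  had a nonzero power in \<open>M\<close>, then every group element would have one in the small subgroup generated by \<open>M \<union> D\<close>.
\<close>

lemma open_has_element_free_modulo:
  fixes G (structure)
  assumes comm: "comm_group G" and semi: "semitopological_group G T"
    and D: "countable D" "D \<subseteq> carrier G" "T closure_of D = topspace T"
    and B: "torsion_free_independent G B" "|UNIV :: real set| \<le>o |B|"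
    and M: "M \<subseteq> carrier G" "|M| <o |UNIV :: real set|"
    and U: "openin T U" "U \<noteq> {}"
  shows "\<exists>u\<in>U. \<forall>n::int. n \<noteq> 0 \<longrightarrow> u [^] n \<notin> M"
proof (rule ccontr)
  interpret comm_group G by (rule comm)
  interpret semitopological_group G T by (rule semi)
  assume "\<not> ?thesis"
  then have pow: "\<exists>n::int. n \<noteq> 0 \<and> u [^] n \<in> M" if "u \<in> U" for u using that by blast
  let ?N = "generate G (M \<union> D)"
  have N: "subgroup ?N G" using M(1) D(2) by (intro generate_is_subgroup) auto
  have Nless: "|?N| <o |UNIV :: real set|"
  proof (rule card_of_generate_less[OF _ _ nat_less_real])
    have "|D| <o |UNIV :: real set|"
      using D(1) nat_less_real countable_card_of_nat ordLeq_ordLess_trans by blast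
    then show "|M \<union> D| <o |UNIV :: real set|"
      using M(2) infinite_UNIV_char_0 by (intro card_of_Un_ordLess_infinite) auto
  qed (use M(1) D(2) in auto)
  have "\<exists>n::int. n \<noteq> 0 \<and> x [^] n \<in> ?N" if x: "x \<in> carrier G" for x
  proof -
    let ?V = "{y \<in> topspace T. inv x \<otimes> y \<in> U}"
    have "openin T ?V"
      using continuous_left_translation[of "inv x"] x U(1) openin_continuous_map_preimage by fastforce
    moreover have "?V \<noteq> {}"
    proof -
      obtain u where u: "u \<in> U" using U(2) by blast
      then have "u \<in> carrier G" using openin_subset[OF U(1)] topspace_eq_carrier by auto
      then have "x \<otimes> u \<in> ?V" using x u by (simp add: topspace_eq_carrier flip: m_assoc)
      then show ?thesis by blast
    qed
    ultimately obtain d where d: "d \<in> D" "inv x \<otimes> d \<in> U"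
      using D(3) unfolding dense_intersects_open by fast
    define u where "u = inv x \<otimes> d"
    have c: "d \<in> carrier G" "u \<in> carrier G" using d D(2) x by (auto simp: u_def)
    obtain n :: int where n: "n \<noteq> 0" "u [^] n \<in> M" using pow d(2) by (auto simp: u_def)
    have "x = d \<otimes> inv u" using x c by (simp add: u_def inv_mult_group flip: m_assoc)
    then have "x [^] n = d [^] n \<otimes> inv (u [^] n)"
      using c by (simp add: int_pow_distrib int_pow_inv)
    moreover have "d [^] n \<in> ?N"
      using d(1) N by (intro subgroup_int_pow_closed) (auto intro: generate.incl)
    moreover have "inv (u [^] n) \<in> ?N"
      using n(2) by (auto intro: generate.inv)
    ultimately show ?thesis using n(1) by (intro exI[of _ n]) (simp add: generate.eng)
  qed
  moreover have "B \<subseteq> carrier G"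
    using B(1) by (auto simp: torsion_free_independent_def independent_subset_def)
  ultimately have "|B| \<le>o |?N|" using independent_card_le[OF B(1)] by blast
  then have "|B| <o |B|"
    using Nless B(2) ordLeq_ordLess_trans ordLess_ordLeq_trans by blast
  then show False using ordLess_irreflexive by blast
qed

section \<open>Dense subsets and dense subgroups\<close>

text \<open>
  For \<open>V\<close> open, \<open>D \<inter> V\<close> is dense in \<open>V\<close>; hence \<open>V\<close> lies in the interior of the closure of
  \<open>D \<inter> V\<close>, and regularity makes that closure fit into a given open set.
\<close>

lemma regular_dense_pi_base:
  assumes reg: "regular_space T" and D: "T closure_of D = topspace T"
    and U: "openin T U" "U \<noteq> {}"
  obtains A where "A \<subseteq> D" "T interior_of (T closure_of A) \<noteq> {}"
    "T interior_of (T closure_of A) \<subseteq> U"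
proof -
  obtain x where x: "x \<in> U" using U(2) by blast
  then obtain V C where V: "openin T V" "closedin T C" "x \<in> V" "V \<subseteq> C" "C \<subseteq> U"
    using reg U(1) unfolding neighbourhood_base_of_closedin[symmetric] neighbourhood_base_of
    by metis
  have "V \<subseteq> T closure_of (D \<inter> V)"
  proof
    fix v assume v: "v \<in> V"
    show "v \<in> T closure_of (D \<inter> V)"
      unfolding in_closure_of
    proof (intro conjI allI impI)
      show "v \<in> topspace T" using v openin_subset[OF V(1)] by blast
      fix W assume W: "v \<in> W \<and> openin T W"
      then have "openin T (V \<inter> W)" "V \<inter> W \<noteq> {}" using V(1) v by auto
      then show "\<exists>y. y \<in> D \<inter> V \<and> y \<in> W"
        using D unfolding dense_intersects_open by blast
    qed
  qed
  then have "V \<subseteq> T interior_of (T closure_of (D \<inter> V))"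
    using V(1) by (simp add: interior_of_maximal)
  moreover have "T closure_of (D \<inter> V) \<subseteq> C"
    using V by (intro closure_of_minimal) auto
  ultimately show ?thesis
    using that[of "D \<inter> V"] V(3,5) interior_of_subset[of T "T closure_of (D \<inter> V)"] by blast
qed

lemma dense_subgroup_separableE:
  assumes G: "group G" and sep: "dense_subgroup_separable G T" and K: "dense_subgroup K G T"
  obtains H where "dense_subgroup H G T" "countable H" "H \<subseteq> K"
proof -
  interpret group G by (rule G)
  have K': "subgroup K G" "T closure_of K = topspace T"
    using K by (auto simp: dense_subgroup_def)
  obtain C where C: "countable C" "C \<subseteq> topspace (subtopology T K)"
    "subtopology T K closure_of C = topspace (subtopology T K)"
    using sep K unfolding dense_subgroup_separable_def separable_space_def by blast
  have CK: "C \<subseteq> K" "C \<subseteq> carrier G"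
    using C(2) subgroup.subset[OF K'(1)] by auto
  have "topspace T \<inter> K \<subseteq> T closure_of C"
    using C(3) CK(1) by (auto simp: closure_of_subtopology Int_absorb1)
  then have "T closure_of (topspace T \<inter> K) \<subseteq> T closure_of C"
    by (simp add: closure_of_minimal)
  then have "topspace T \<subseteq> T closure_of C"
    using K'(2) closure_of_restrict by metis
  moreover have "T closure_of C \<subseteq> T closure_of generate G C"
    by (intro closure_of_mono) (auto intro: generate.incl)
  ultimately have "T closure_of generate G C = topspace T"
    using closure_of_subset_topspace by (metis subset_antisym subset_trans)
  then have "dense_subgroup (generate G C) G T"
    using generate_is_subgroup[OF CK(2)] by (simp add: dense_subgroup_def)
  moreover have "generate G C \<subseteq> K" using generate_subgroup_incl[OF CK(1) K'(1)] .
  ultimately show ?thesis using that countable_generate[OF CK(2) C(1)] by blast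
qed

text \<open>
  Recursion runs along the cardinal order of the index set \<open>I\<close> of the \<open>\<pi>\<close>-base: its proper initial
  segments have fewer than \<open>\<cc>\<close> elements, so the subgroup generated by \<open>S\<close> and the points chosen
  earlier is always small enough for another point to be free of it.
\<close>

lemma exists_dense_subgroup_avoiding:
  fixes G :: "('a, 'b) monoid_scheme" (structure)
  assumes comm: "comm_group G" and semi: "semitopological_group G T"
    and reg: "regular_space T"
    and D: "countable D" "D \<subseteq> carrier G" "T closure_of D = topspace T"
    and B: "torsion_free_independent G B" "|UNIV :: real set| \<le>o |B|"
    and S: "subgroup S G" "|S| <o |UNIV :: real set|"
  obtains K where "dense_subgroup K G T" "S \<inter> K = {\<one>}"
proof -
  interpret comm_group G by (rule comm)
  interpret semitopological_group G T by (rule semi)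
  define u where "u A = T interior_of (T closure_of A)" for A
  define I where "I = {A. A \<subseteq> D \<and> u A \<noteq> {}}"
  have Icard: "|I| \<le>o |UNIV :: real set|"
  proof -
    have "|I| \<le>o |Pow D|" by (intro card_of_mono1) (auto simp: I_def)
    also have "|Pow D| \<le>o |Pow (UNIV :: nat set)|"
      using D(1) inj_on_image_Pow[of _ D] unfolding countable_def
      by (metis Pow_UNIV card_of_ordLeqI UNIV_I)
    also have "|Pow (UNIV :: nat set)| =o |UNIV :: real set|"
      using nat_sets_eqpoll_reals eqpoll_iff_card_of_ordIso by (metis Pow_UNIV)
    finally show ?thesis .
  qed
  define r where "r = |I|"
  have r: "Well_order r" "Field r = I" "Card_order r"
    by (simp_all add: r_def card_of_well_order_on Field_card_of card_of_card_order_on)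
  have wf: "wf (r - Id)" using r(1) by (simp add: well_order_on_def)
  have under: "y \<in> underS r i \<longleftrightarrow> (y, i) \<in> r - Id" for y i by (auto simp: underS_def)
  define P where "P f i x \<longleftrightarrow> (i \<in> I \<longrightarrow>
      x \<in> u i \<and> (\<forall>n::int. n \<noteq> 0 \<longrightarrow> x [^] n \<notin> generate G (S \<union> f ` underS r i)))" for f i x
  have uc: "u A \<subseteq> carrier G" for A
    using openin_subset[of T "u A"] by (simp add: u_def topspace_eq_carrier)
  have "\<exists>f. \<forall>i. P f i (f i)"
  proof (rule dependent_wf_choice[OF wf])
    fix f g :: "'a set \<Rightarrow> 'a" and i x assume "\<And>z. (z, i) \<in> r - Id \<Longrightarrow> f z = g z"
    then have "f ` underS r i = g ` underS r i" by (intro image_cong) (auto simp: under)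
    then show "P f i x = P g i x" by (simp add: P_def)
  next
    fix i and f :: "'a set \<Rightarrow> 'a" assume IH: "\<And>y. (y, i) \<in> r - Id \<Longrightarrow> P f y (f y)"
    show "\<exists>x. P f i x"
    proof (cases "i \<in> I")
      case True
      let ?X = "S \<union> f ` underS r i"
      have "f y \<in> carrier G" if "y \<in> underS r i" for y
      proof -
        have "y \<in> I" using that r(2) by (auto simp: underS_def Field_def)
        then show ?thesis using IH[of y] that uc by (auto simp: under P_def)
      qed
      then have X: "?X \<subseteq> carrier G" using subgroup.subset[OF S(1)] by auto
      have "|underS r i| <o r" using card_of_underS[OF r(3)] r(2) True by simp
      then have "|underS r i| <o |UNIV :: real set|"
        using ordLess_ordLeq_trans[OF _ Icard] by (simp only: r_def)
      then have "|f ` underS r i| <o |UNIV :: real set|"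
        by (rule ordLeq_ordLess_trans[OF card_of_image])
      then have "|?X| <o |UNIV :: real set|"
        using S(2) infinite_UNIV_char_0 by (intro card_of_Un_ordLess_infinite) auto
      then have "|generate G ?X| <o |UNIV :: real set|"
        by (rule card_of_generate_less[OF X _ nat_less_real])
      moreover have "openin T (u i)" "u i \<noteq> {}" using True by (auto simp: u_def I_def)
      ultimately have "\<exists>x\<in>u i. \<forall>n::int. n \<noteq> 0 \<longrightarrow> x [^] n \<notin> generate G ?X"
        using open_has_element_free_modulo[OF comm semi D B generate_incl[OF X]] by blast
      then show ?thesis by (auto simp: P_def)
    qed (simp add: P_def)
  qed
  then obtain f where f: "\<And>i. P f i (f i)" by blast
  have fu: "f i \<in> u i" if "i \<in> I" for i using f that by (auto simp: P_def)
  let ?K = "generate G (f ` I)"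
  have fc: "f i \<in> carrier G" if "i \<in> I" for i using fu uc that by blast
  have "S \<inter> ?K = {\<one>}"
    using generate_Int_trivial[OF r(1) S(1), of f] f fc unfolding r(2) P_def by blast
  moreover have "dense_subgroup ?K G T"
    unfolding dense_subgroup_def dense_intersects_open
  proof (intro conjI allI impI)
    show "subgroup ?K G" using fc by (intro generate_is_subgroup) auto
    fix U assume U: "openin T U \<and> U \<noteq> {}"
    obtain A where "A \<subseteq> D" "u A \<noteq> {}" and AU: "u A \<subseteq> U"
      using regular_dense_pi_base[OF reg D(3) conjunct1[OF U] conjunct2[OF U]] unfolding u_def .
    then have "A \<in> I" by (simp add: I_def)
    then have "f A \<in> ?K \<inter> U" using fu AU by (auto intro: generate.incl)
    then show "?K \<inter> U \<noteq> {}" by blast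
  qed
  ultimately show ?thesis using that by blast
qed

theorem theorem4p17:
  fixes G :: "('a, 'b) monoid_scheme" and T :: "'a topology"
  assumes "comm_group G"
    and "semitopological_group G T"
    and "Hausdorff_space T"
    and "regular_space T"
    and "dense_subgroup_separable G T"
    and "|UNIV :: real set| \<le>o torsion_free_rank G"
  shows "d_independent G T"
proof -
  interpret comm_group G by (rule assms(1))
  interpret semitopological_group G T by (rule assms(2))
  define B where "B = (SOME B. maximal_torsion_free_independent G B)"
  have B: "torsion_free_independent G B"
    using someI_ex[OF ex_maximal_torsion_free_independent[of G]]
    by (simp add: B_def maximal_torsion_free_independent_def)
  have Bcard: "|UNIV :: real set| \<le>o |B|"
    using assms(6) by (simp add: torsion_free_rank_def B_def)
  have "carrier G \<noteq> {\<one>\<^bsub>G\<^esub>}"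
  proof -
    have "B \<noteq> {}" using Bcard card_of_empty3 by fastforce
    then obtain b where "b \<in> B" by blast
    then have "b \<in> carrier G" "ord b = 0"
      using B by (auto simp: torsion_free_independent_def independent_subset_def)
    then show ?thesis using ord_eq_1 by fastforce
  qed
  moreover have "dense_subgroup (carrier G) G T"
    using subgroup_self closure_of_topspace[of T] by (simp add: dense_subgroup_def topspace_eq_carrier)
  then obtain D where "dense_subgroup D G T" "countable D"
    using dense_subgroup_separableE[OF is_group assms(5)] by metis
  then have D: "countable D" "D \<subseteq> carrier G" "T closure_of D = topspace T"
    by (auto simp: dense_subgroup_def dest: subgroup.subset)
  have "\<exists>H. dense_subgroup H G T \<and> countable H \<and> S \<inter> H = {\<one>\<^bsub>G\<^esub>}"
    if S: "subgroup S G" "|S| <o |UNIV :: real set|" for S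
  proof -
    obtain K where K: "dense_subgroup K G T" "S \<inter> K = {\<one>\<^bsub>G\<^esub>}"
      using exists_dense_subgroup_avoiding[OF assms(1,2,4) D B Bcard S] .
    obtain H where H: "dense_subgroup H G T" "countable H" "H \<subseteq> K"
      using dense_subgroup_separableE[OF is_group assms(5) K(1)] .
    have "\<one>\<^bsub>G\<^esub> \<in> S \<inter> H"
      using S(1) H(1) by (simp add: dense_subgroup_def subgroup.one_closed)
    then show ?thesis using H K(2) by blast
  qed
  ultimately show ?thesis
    using assms(2) by (simp add: d_independent_def)
qed

end
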